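(* Let $G=(V,E)$ be a compact topological packing graph with stability number $\alpha(G)$. Suppose that the problem \begin{align*} \inf_{K\in\mathcal{K}(V),\ \lambda\in\mathbb{R}}\ \lambda\quad\text{s.t.}\quad & K(v,v)=\lambda-1 \text{ for all } v\in V,\\ & K(u,v)=-1\text{ for all distinct }u,v\in V\text{ with }(u,v)\notin E,\\ & K\in\mathrm{COP}(V) \end{align*} is strictly feasible, i.e. there is a feasible pair $(K^+,\lambda^+)$ with $K^+\in\operatorname{int}\mathrm{COP}(V)$. For $r\ge 0$ let $\gamma_r(G)$ (respectively $\nu_r(G)$) be the optimal value (infimum) of the problem obtained from the one above by replacing the constraint $K\in\mathrm{COP}(V)$ with $K\in\mathcal{C}^V_r$ (respectively $K\in Q^V_r$). Then $\gamma_r(G)\downarrow\alpha(G)$ and $\nu_r(G)\downarrow\alpha(G)$ as $r\to\infty$ (that is, both sequences are nonincreasing and converge to $\alpha(G)$).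
   Context: A compact topological packing graph is a graph whose vertex set is a (nonempty) compact Hausdorff topological space and in which every finite clique is contained in an open clique. Graphs are simple and undirected. The stability number $\alpha(G)$ is the maximum number of vertices no two of which are adjacent. The infimum over an empty feasible set is $+\infty$. $\mathcal{K}(V)$ denotes the set of kernels on $V$: continuous functions $F:V\times V\to\mathbb{R}$ with $F(x,y)=F(y,x)$ for all $x,y\in V$. For $K\in\mathcal{K}(V)$ and $U\subseteq V$, $K^U$ is the restriction of $K$ to $U\times U$ (for finite $U$ it is identified with a symmetric $|U|\times|U|$ matrix). A real symmetric matrix $M$ is copositive if $x^\top Mx\ge 0$ for all $x$ with nonnegative entries. $K\in\mathcal{K}(V)$ is PSD (resp. copositive) if for every finite $U\subset V$ the matrix $K^U$ is positive semidefinite (resp. copositive); $\mathrm{PSD}(V)$ and $\mathrm{COP}(V)$ denote the sets of PSD and of copositive kernels on $V$. $\operatorname{int}$ denotes the interior in $\mathcal{K}(V)$ with respect to the supremum norm. A tensor of order $r$ over $V$ is a function $V^r\to\mathbb{R}$ (not necessarily continuous); $\mathcal{T}^V_r$ is the set of these, and $\mathcal{N}^V_r$ is the set of those that are nonnegative everywhere. A kernel is regarded as a tensor of order $2$. For $r\ge 0$, the stack operator $\mathbf{Stk}^r:\mathcal{T}^V_d\to\mathcal{T}^V_{d+r}$ is $\mathbf{Stk}^r(T)(u,v)=T(u)$ for $u\in V^d$, $v\in V^r$. The symmetrization $\sigma:\mathcal{T}^V_d\to\mathcal{T}^V_d$ is $\sigma(T)(v)=\frac{1}{d!}\sum_{\pi\in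 Sym(d)}T(\pi v)$, where $Sym(d)$ is the group of permutations of $d$ elements and $\pi v=(v_{\pi(1)},\dots,v_{\pi(d)})$. A tensor $F\in\mathcal{T}^V_{r+2}$ is 2-PSD on $V$ if it is continuous and for all $z\in V^r$, $F(\cdot,\cdot,z)\in\mathrm{PSD}(V)$. For an integer $r\ge 0$: $\mathcal{C}^V_r=\{M\in\mathcal{K}(V):\ \sigma(\mathbf{Stk}^r(M))=\sigma(N)\text{ for some }N\in\mathcal{N}^V_{r+2}\}$, and $Q^V_r=\{M\in\mathcal{K}(V):\ \sigma(\mathbf{Stk}^r(M))=\sigma(N)+\sigma(S)\text{ for some }N\in\mathcal{N}^V_{r+2}\text{ and some 2-PSD }S\in\mathcal{T}^V_{r+2}\}$. *)

theory Defs
  imports "HOL-Analysis.Analysis" "HOL-Library.Ramsey"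
begin

text \<open>
  The vertex set is the whole type \<open>'a\<close>; an undirected simple graph is a set of two-element
  sets of vertices, and \<^const>\<open>clique\<close>, \<^const>\<open>indep\<close> are those of \<^theory>\<open>HOL-Library.Ramsey\<close>.
\<close>

definition compact_packing_graph :: "'a::t2_space set set \<Rightarrow> bool" where
  "compact_packing_graph E \<longleftrightarrow>
     compact (UNIV :: 'a set) \<and>
     E \<subseteq> nsets UNIV 2 \<and>
     (\<forall>C. finite C \<and> clique C E \<longrightarrow> (\<exists>U. open U \<and> clique U E \<and> C \<subseteq> U))"

definition stability_number :: "'a set set \<Rightarrow> enat" where
  "stability_number E = (SUP S\<in>{S. finite S \<and> indep S E}. enat (card S))"

definition kernels :: "('a::topological_space \<Rightarrow> 'a \<Rightarrow> real) set" where
  "kernels = {F. continuous_on UNIV (\<lambda>(x, y). F x y) \<and> (\<forall>x y. F x y = F y x)}"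

definition psd_matrix :: "'a set \<Rightarrow> ('a \<Rightarrow> 'a \<Rightarrow> real) \<Rightarrow> bool" where
  "psd_matrix U M \<longleftrightarrow>
     (\<forall>x :: 'a \<Rightarrow> real. 0 \<le> (\<Sum>u\<in>U. \<Sum>v\<in>U. x u * M u v * x v))"

definition copositive_matrix :: "'a set \<Rightarrow> ('a \<Rightarrow> 'a \<Rightarrow> real) \<Rightarrow> bool" where
  "copositive_matrix U M \<longleftrightarrow>
     (\<forall>x :: 'a \<Rightarrow> real. (\<forall>u\<in>U. 0 \<le> x u) \<longrightarrow> 0 \<le> (\<Sum>u\<in>U. \<Sum>v\<in>U. x u * M u v * x v))"

definition PSD :: "('a::topological_space \<Rightarrow> 'a \<Rightarrow> real) set" where
  "PSD = {K \<in> kernels. \<forall>U. finite U \<longrightarrow> psd_matrix U K}"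

definition COP :: "('a::topological_space \<Rightarrow> 'a \<Rightarrow> real) set" where
  "COP = {K \<in> kernels. \<forall>U. finite U \<longrightarrow> copositive_matrix U K}"

text \<open>
  The distance of bounded continuous functions is the supremum distance. Over a compact space
  every kernel is bounded, so \<^const>\<open>Bcontfun\<close> loses nothing there.
\<close>

definition kernel_dist ::
  "('a::topological_space \<Rightarrow> 'a \<Rightarrow> real) \<Rightarrow> ('a \<Rightarrow> 'a \<Rightarrow> real) \<Rightarrow> real" where
  "kernel_dist F G = dist (Bcontfun (\<lambda>(x, y). F x y)) (Bcontfun (\<lambda>(x, y). G x y))"

definition kernel_topology :: "('a::topological_space \<Rightarrow> 'a \<Rightarrow> real) topology" where
  "kernel_topology = Metric_space.mtopology kernels kernel_dist"

lemma kernel_bcontfun: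
  fixes F :: "'a::topological_space \<Rightarrow> 'a \<Rightarrow> real"
  assumes "compact (UNIV :: 'a set)" "F \<in> kernels"
  shows "(\<lambda>(x, y). F x y) \<in> bcontfun"
proof -
  have "compact (UNIV \<times> UNIV :: ('a \<times> 'a) set)"
    using assms(1) by (intro compact_Times)
  then have "compact (range (\<lambda>(x, y). F x y))"
    using assms(2) by (intro compact_continuous_image) (auto simp: kernels_def)
  then show ?thesis
    using assms(2) by (auto simp: kernels_def bcontfun_def intro: compact_imp_bounded)
qed

lemma kernel_dist_eq:
  fixes F :: "'a::topological_space \<Rightarrow> 'a \<Rightarrow> real"
  assumes "compact (UNIV :: 'a set)" "F \<in> kernels" "G \<in> kernels"
  shows "kernel_dist F G = (SUP (x, y). \<bar>F x y - G x y\<bar>)"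
  using kernel_bcontfun[OF assms(1,2)] kernel_bcontfun[OF assms(1,3)]
  by (simp add: kernel_dist_def dist_bcontfun_def Bcontfun_inverse dist_real_def case_prod_beta)

lemma Metric_space_kernels:
  assumes "compact (UNIV :: 'a::topological_space set)"
  shows "Metric_space (kernels :: ('a \<Rightarrow> 'a \<Rightarrow> real) set) kernel_dist"
proof
  fix F G :: "'a \<Rightarrow> 'a \<Rightarrow> real"
  assume "F \<in> kernels" "G \<in> kernels"
  then show "kernel_dist F G = 0 \<longleftrightarrow> F = G"
    using kernel_bcontfun[OF assms] by (auto simp: kernel_dist_def Bcontfun_inject fun_eq_iff)
qed (auto simp: kernel_dist_def dist_commute dist_triangle)

text \<open>
  Tensors of order \<open>d\<close> are real functions on the extensional tuples \<open>tuples d\<close>; their values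
  elsewhere are irrelevant. Precomposition with a permutation of \<open>{..<d}\<close> preserves \<open>tuples d\<close>.
\<close>

abbreviation tuples :: "nat \<Rightarrow> (nat \<Rightarrow> 'a) set" where
  "tuples d \<equiv> {..<d} \<rightarrow>\<^sub>E UNIV"

definition kernel_tensor :: "('a \<Rightarrow> 'a \<Rightarrow> real) \<Rightarrow> (nat \<Rightarrow> 'a) \<Rightarrow> real" where
  "kernel_tensor K = (\<lambda>v. K (v 0) (v 1))"

text \<open>\<open>stk d T\<close> stacks a tensor of order \<open>d\<close>; its value does not involve the final order.\<close>

definition stk :: "nat \<Rightarrow> ((nat \<Rightarrow> 'a) \<Rightarrow> real) \<Rightarrow> (nat \<Rightarrow> 'a) \<Rightarrow> real" where
  "stk d T = (\<lambda>w. T (restrict w {..<d}))"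

definition symmetrize :: "nat \<Rightarrow> ((nat \<Rightarrow> 'a) \<Rightarrow> real) \<Rightarrow> (nat \<Rightarrow> 'a) \<Rightarrow> real" where
  "symmetrize d T = (\<lambda>v. (\<Sum>\<pi> | \<pi> permutes {..<d}. T (v \<circ> \<pi>)) / fact d)"

definition nonneg_tensors :: "nat \<Rightarrow> ((nat \<Rightarrow> 'a) \<Rightarrow> real) set" where
  "nonneg_tensors d = {N. \<forall>v\<in>tuples d. 0 \<le> N v}"

text \<open>For \<open>z \<in> tuples r\<close>, \<open>case_nat x (case_nat y z)\<close> is the tuple \<open>(x, y, z)\<close> in \<open>tuples (r + 2)\<close>.\<close>

definition two_PSD :: "nat \<Rightarrow> ((nat \<Rightarrow> 'a::topological_space) \<Rightarrow> real) set" where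
  "two_PSD r = {F. continuous_map (product_topology (\<lambda>_. euclidean) {..<r + 2}) euclideanreal F \<and>
     (\<forall>z\<in>tuples r. (\<lambda>x y. F (case_nat x (case_nat y z))) \<in> PSD)}"

definition C_cone :: "nat \<Rightarrow> ('a::topological_space \<Rightarrow> 'a \<Rightarrow> real) set" where
  "C_cone r = {M \<in> kernels. \<exists>N\<in>nonneg_tensors (r + 2). \<forall>v\<in>tuples (r + 2).
     symmetrize (r + 2) (stk 2 (kernel_tensor M)) v = symmetrize (r + 2) N v}"

definition Q_cone :: "nat \<Rightarrow> ('a::topological_space \<Rightarrow> 'a \<Rightarrow> real) set" where
  "Q_cone r = {M \<in> kernels. \<exists>N\<in>nonneg_tensors (r + 2). \<exists>S\<in>two_PSD r. \<forall>v\<in>tuples (r + 2).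
     symmetrize (r + 2) (stk 2 (kernel_tensor M)) v =
       symmetrize (r + 2) N v + symmetrize (r + 2) S v}"

definition feasible_pairs ::
  "'a::topological_space set set \<Rightarrow> ('a \<Rightarrow> 'a \<Rightarrow> real) set \<Rightarrow> (('a \<Rightarrow> 'a \<Rightarrow> real) \<times> real) set" where
  "feasible_pairs E \<C> = {(K, l). K \<in> kernels \<and> (\<forall>v. K v v = l - 1) \<and>
     (\<forall>u v. u \<noteq> v \<and> {u, v} \<notin> E \<longrightarrow> K u v = -1) \<and> K \<in> \<C>}"

definition optimal_value ::
  "'a::topological_space set set \<Rightarrow> ('a \<Rightarrow> 'a \<Rightarrow> real) set \<Rightarrow> ereal" where
  "optimal_value E \<C> = (INF (K, l)\<in>feasible_pairs E \<C>. ereal l)"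

definition strictly_feasible :: "'a::topological_space set set \<Rightarrow> bool" where
  "strictly_feasible E \<longleftrightarrow>
     (\<exists>(K, l)\<in>feasible_pairs E COP. K \<in> kernel_topology interior_of COP)"

definition gamma_bound :: "'a::topological_space set set \<Rightarrow> nat \<Rightarrow> ereal" where
  "gamma_bound E r = optimal_value E (C_cone r)"

definition nu_bound :: "'a::topological_space set set \<Rightarrow> nat \<Rightarrow> ereal" where
  "nu_bound E r = optimal_value E (Q_cone r)"

end

theory Submission
  imports Defs
begin

text \<open>
  The cones are nested, \<open>C_cone r \<subseteq> Q_cone r \<subseteq> COP\<close> (sum the defining identity over all tuples with
  product weights), and testing a copositive kernel with a maximum independent set gives the lower
  bound \<open>\<alpha>\<close>. The copositive problem attains \<open>\<alpha>\<close>: by compactness of \<open>V\<^sup>\<alpha>\<^sup>+\<^sup>1\<close> there are finitely many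
  points \<open>x\<close> with a partition of unity \<open>p x\<close> such that declaring \<open>x\<close>, \<open>y\<close> related when the supports
  of \<open>p x\<close> and \<open>p y\<close> are completely joined yields a finite graph with stability number at most \<open>\<alpha>\<close>.
  The kernel \<open>F u v = (\<Sum>x y related. p x u * p y v)\<close> vanishes on nonadjacent pairs, and the
  Motzkin-Straus inequality for the finite graph makes \<open>\<alpha> * F - 1\<close> copositive. Mixing the optimal
  kernel with a little of the strictly feasible one gives a kernel whose quadratic form is bounded
  below by \<open>\<delta> * (\<Sum>x)\<^sup>2\<close>, and an averaging argument of Polya type puts such a kernel into some
  \<open>C_cone r\<close>.
\<close>

subsection \<open>Symmetrized tensors and the cones\<close>

lemma permutes_comp_tuples:
  assumes "\<pi> permutes {..<d}" "v \<in> tuples d"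
  shows "v \<circ> \<pi> \<in> tuples d"
  using assms by (auto simp: PiE_def extensional_def permutes_not_in)

lemma restrict_tuples [simp]: "restrict w {..<d} \<in> tuples d"
  by auto

lemma symmetrize_cong:
  assumes "\<And>w. w \<in> tuples d \<Longrightarrow> A w = B w" "v \<in> tuples d"
  shows "symmetrize d A v = symmetrize d B v"
  unfolding symmetrize_def
  by (intro arg_cong2[where f="(/)"] sum.cong refl assms(1) permutes_comp_tuples assms(2)) simp

text \<open>A permutation of the first \<open>d\<close> positions is also one of all
  \<open>n\<close> positions, so composing with it only reindexes the outer sum; the inner average
  is absorbed.\<close>

lemma symmetrize_stk_symmetrize:
  assumes "d \<le> n"
  shows "symmetrize n (stk d (symmetrize d T)) v = symmetrize n (stk d T) v"
proof -
  let ?P = "\<lambda>d. {\<pi>. \<pi> permutes {..<d::nat}}"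
  have restr: "restrict w {..<d} \<circ> \<rho> = restrict (w \<circ> \<rho>) {..<d}" if "\<rho> \<in> ?P d" for w :: "nat \<Rightarrow> 'a" and \<rho>
  proof
    fix i show "(restrict w {..<d} \<circ> \<rho>) i = restrict (w \<circ> \<rho>) {..<d} i"
      using that permutes_in_image[of \<rho> "{..<d}" i] by auto
  qed
  have "(\<Sum>\<pi>\<in>?P n. \<Sum>\<rho>\<in>?P d. T (restrict (v \<circ> \<pi>) {..<d} \<circ> \<rho>))
      = (\<Sum>\<rho>\<in>?P d. \<Sum>\<pi>\<in>?P n. T (restrict (v \<circ> (\<pi> \<circ> \<rho>)) {..<d}))"
    by (subst sum.swap) (auto intro!: sum.cong simp: restr comp_assoc)
  also have "\<dots> = (\<Sum>\<rho>\<in>?P d. \<Sum>\<pi>\<in>?P n. T (restrict (v \<circ> \<pi>) {..<d}))"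
  proof (rule sum.cong[OF refl])
    fix \<rho> assume "\<rho> \<in> ?P d"
    then have "\<rho> permutes {..<n}"
      using assms by (auto intro: permutes_subset)
    then show "(\<Sum>\<pi>\<in>?P n. T (restrict (v \<circ> (\<pi> \<circ> \<rho>)) {..<d})) = (\<Sum>\<pi>\<in>?P n. T (restrict (v \<circ> \<pi>) {..<d}))"
      using sum_permutations_compose_right[of \<rho> "{..<n}" "\<lambda>\<pi>. T (restrict (v \<circ> \<pi>) {..<d})"] by simp
  qed
  also have "\<dots> = fact d * (\<Sum>\<pi>\<in>?P n. T (restrict (v \<circ> \<pi>) {..<d}))"
    by (simp add: card_permutations)
  finally show ?thesis
    by (simp add: symmetrize_def stk_def sum_divide_distrib[symmetric])
qed

lemma symmetrize_idem:
  "v \<in> tuples d \<Longrightarrow> symmetrize d (symmetrize d T) v = symmetrize d T v"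
proof -
  assume v: "v \<in> tuples d"
  have stk: "stk d A w = A w" if "w \<in> tuples d" for A :: "(nat \<Rightarrow> 'a) \<Rightarrow> real" and w
  proof -
    have "restrict w {..<d} = w" using that by (metis PiE_restrict)
    then show ?thesis by (simp add: stk_def)
  qed
  show ?thesis
    using symmetrize_stk_symmetrize[of d d T v] symmetrize_cong[of d _ _ v, OF stk v] by simp
qed

lemma stk_stk: "k \<le> d \<Longrightarrow> stk d (stk k T) = stk k T"
  by (auto simp: stk_def fun_eq_iff Int_absorb1)

text \<open>By absorption each side depends only on the symmetrization of its tensor; this carries a
  certificate from one level of the hierarchy to the next.\<close>

lemma symmetrize_stk_Suc:
  assumes "\<And>w. w \<in> tuples d \<Longrightarrow> symmetrize d A w = symmetrize d B w" "v \<in> tuples (Suc d)"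
  shows "symmetrize (Suc d) (stk d A) v = symmetrize (Suc d) (stk d B) v"
proof -
  have "symmetrize (Suc d) (stk d A) v = symmetrize (Suc d) (stk d (symmetrize d A)) v"
    by (simp add: symmetrize_stk_symmetrize)
  also have "\<dots> = symmetrize (Suc d) (stk d (symmetrize d B)) v"
    using assms by (intro symmetrize_cong) (auto simp: stk_def)
  finally show ?thesis
    by (simp add: symmetrize_stk_symmetrize)
qed

lemma symmetrize_add:
  "symmetrize d (\<lambda>v. A v + B v) v = symmetrize d A v + symmetrize d B v"
  by (simp add: symmetrize_def sum.distrib add_divide_distrib)

lemma stk_nonneg: "N \<in> nonneg_tensors d \<Longrightarrow> stk d N \<in> nonneg_tensors n"
  by (auto simp: nonneg_tensors_def stk_def)

lemma restrict_case_nat: "restrict (case_nat x z) {..<Suc n} = case_nat x (restrict z {..<n})"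
  by (auto simp: fun_eq_iff split: nat.split)

text \<open>The new coordinate is appended last, so every slice in the first two arguments is a
  slice of \<open>S\<close> at a shortened \<open>z\<close>.\<close>

lemma stk_two_PSD:
  assumes "S \<in> two_PSD r"
  shows "stk (r + 2) S \<in> two_PSD (Suc r)"
proof -
  let ?X = "\<lambda>d. product_topology (\<lambda>_. euclidean :: 'a topology) {..<d}"
  have "continuous_map (?X (r + 2)) euclideanreal S"
    using assms by (simp add: two_PSD_def)
  moreover have "continuous_map (?X (Suc r + 2)) (?X (r + 2)) (\<lambda>w. restrict w {..<r + 2})"
    by (auto simp: continuous_map_componentwise intro!: continuous_map_product_projection)
  ultimately have "continuous_map (?X (Suc r + 2)) euclideanreal (stk (r + 2) S)"
    using continuous_map_compose unfolding stk_def o_def by blast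
  moreover have "stk (r + 2) S (case_nat x (case_nat y z)) = S (case_nat x (case_nat y (restrict z {..<r})))"
    for x y and z :: "nat \<Rightarrow> 'a"
    by (simp add: stk_def restrict_case_nat)
  ultimately show ?thesis
    using assms by (simp add: two_PSD_def)
qed

section \<open>Nesting of the cones\<close>

lemma C_cone_Suc: "C_cone r \<subseteq> C_cone (Suc r)"
proof
  fix M :: "'a \<Rightarrow> 'a \<Rightarrow> real" assume "M \<in> C_cone r"
  then obtain N where M: "M \<in> kernels" and N: "N \<in> nonneg_tensors (r + 2)"
    and eq: "\<And>v. v \<in> tuples (r + 2) \<Longrightarrow>
      symmetrize (r + 2) (stk 2 (kernel_tensor M)) v = symmetrize (r + 2) N v"
    by (auto simp: C_cone_def)
  have "symmetrize (Suc r + 2) (stk 2 (kernel_tensor M)) v = symmetrize (Suc r + 2) (stk (r + 2) N) v"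
    if "v \<in> tuples (Suc r + 2)" for v
    using symmetrize_stk_Suc[OF eq, of v] that by (simp add: stk_stk)
  then show "M \<in> C_cone (Suc r)"
    using M stk_nonneg[OF N] unfolding C_cone_def by blast
qed

lemma Q_cone_Suc: "Q_cone r \<subseteq> Q_cone (Suc r)"
proof
  fix M :: "'a \<Rightarrow> 'a \<Rightarrow> real" assume "M \<in> Q_cone r"
  then obtain N S where M: "M \<in> kernels" and N: "N \<in> nonneg_tensors (r + 2)" and S: "S \<in> two_PSD r"
    and eq: "\<And>v. v \<in> tuples (r + 2) \<Longrightarrow> symmetrize (r + 2) (stk 2 (kernel_tensor M)) v
      = symmetrize (r + 2) (\<lambda>v. N v + S v) v"
    by (auto simp: Q_cone_def symmetrize_add)
  have "stk (r + 2) (\<lambda>v. N v + S v) = (\<lambda>v. stk (r + 2) N v + stk (r + 2) S v)"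
    by (simp add: stk_def)
  then have "symmetrize (Suc r + 2) (stk 2 (kernel_tensor M)) v =
      symmetrize (Suc r + 2) (stk (r + 2) N) v + symmetrize (Suc r + 2) (stk (r + 2) S) v"
    if "v \<in> tuples (Suc r + 2)" for v
    using symmetrize_stk_Suc[OF eq, of v] that by (simp add: stk_stk symmetrize_add[symmetric])
  then show "M \<in> Q_cone (Suc r)"
    using M stk_nonneg[OF N] stk_two_PSD[OF S] unfolding Q_cone_def by blast
qed

lemma C_cone_subset_Q_cone: "C_cone r \<subseteq> Q_cone r"
proof
  fix M :: "'a \<Rightarrow> 'a \<Rightarrow> real" assume "M \<in> C_cone r"
  then obtain N where M: "M \<in> kernels" and N: "N \<in> nonneg_tensors (r + 2)"
    and eq: "\<And>v. v \<in> tuples (r + 2) \<Longrightarrow>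
      symmetrize (r + 2) (stk 2 (kernel_tensor M)) v = symmetrize (r + 2) N v"
    by (auto simp: C_cone_def)
  have S: "(\<lambda>_. 0) \<in> two_PSD r"
    by (auto simp: two_PSD_def PSD_def kernels_def psd_matrix_def case_prod_beta)
  have "symmetrize (r + 2) (stk 2 (kernel_tensor M)) v =
      symmetrize (r + 2) N v + symmetrize (r + 2) (\<lambda>_. 0) v" if "v \<in> tuples (r + 2)" for v
    using eq[OF that] by (simp add: symmetrize_def)
  then show "M \<in> Q_cone r"
    using M N S unfolding Q_cone_def by blast
qed

section \<open>Inclusion of the cones in the copositive kernels\<close>

lemma sum_tuples_Suc:
  fixes F :: "(nat \<Rightarrow> 'a) \<Rightarrow> 'b::comm_monoid_add"
  shows "(\<Sum>w\<in>{..<Suc n} \<rightarrow>\<^sub>E U. F w) = (\<Sum>a\<in>U. \<Sum>z\<in>{..<n} \<rightarrow>\<^sub>E U. F (case_nat a z))"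
proof -
  have "(\<Sum>a\<in>U. \<Sum>z\<in>{..<n} \<rightarrow>\<^sub>E U. F (case_nat a z))
      = (\<Sum>(a, z)\<in>U \<times> ({..<n} \<rightarrow>\<^sub>E U). F (case_nat a z))"
    by (rule sum.cartesian_product)
  also have "\<dots> = (\<Sum>w\<in>{..<Suc n} \<rightarrow>\<^sub>E U. F w)"
    by (rule sum.reindex_bij_witness[where i="\<lambda>w. (w 0, w \<circ> Suc)" and j="\<lambda>(a, z). case_nat a z"])
      (auto simp: fun_eq_iff PiE_def Pi_def extensional_def split: nat.splits)
  finally show ?thesis by simp
qed

text \<open>The product weight is invariant under permuting coordinates, so all terms of the average
  have the same weighted sum. Identities between symmetrized tensors thus become identities between
  weighted sums.\<close>

lemma sum_weighted_symmetrize: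
  fixes x :: "'a \<Rightarrow> real"
  shows "(\<Sum>w\<in>{..<d} \<rightarrow>\<^sub>E U. (\<Prod>i<d. x (w i)) * symmetrize d T w)
       = (\<Sum>w\<in>{..<d} \<rightarrow>\<^sub>E U. (\<Prod>i<d. x (w i)) * T w)"
proof -
  let ?P = "{\<pi>. \<pi> permutes {..<d}}" and ?W = "{..<d} \<rightarrow>\<^sub>E U"
  have "(\<Sum>w\<in>?W. (\<Prod>i<d. x (w i)) * T (w \<circ> \<pi>)) = (\<Sum>w\<in>?W. (\<Prod>i<d. x (w i)) * T w)"
    if \<pi>: "\<pi> permutes {..<d}" for \<pi>
  proof (rule sum.reindex_bij_witness[where i="\<lambda>w. w \<circ> inv \<pi>" and j="\<lambda>w. w \<circ> \<pi>"])
    have *: "w \<circ> \<rho> \<in> ?W" if "w \<in> ?W" "\<rho> permutes {..<d}" for w \<rho>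
      using that permutes_in_image[OF that(2)]
      by (auto simp: PiE_def Pi_def extensional_def)
    fix w assume w: "w \<in> ?W"
    show "(w \<circ> \<pi>) \<circ> inv \<pi> = w" "(w \<circ> inv \<pi>) \<circ> \<pi> = w"
      using \<pi> by (auto simp: fun_eq_iff permutes_inverses)
    show "w \<circ> \<pi> \<in> ?W" "w \<circ> inv \<pi> \<in> ?W"
      using * w \<pi> permutes_inv[OF \<pi>] by auto
    show "(\<Prod>i<d. x ((w \<circ> \<pi>) i)) * T (w \<circ> \<pi>) = (\<Prod>i<d. x (w i)) * T (w \<circ> \<pi>)"
      using prod.permute[OF \<pi>, of "\<lambda>i. x (w i)"] by (simp add: o_def)
  qed
  then have "(\<Sum>\<pi>\<in>?P. \<Sum>w\<in>?W. (\<Prod>i<d. x (w i)) * T (w \<circ> \<pi>))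
      = fact d * (\<Sum>w\<in>?W. (\<Prod>i<d. x (w i)) * T w)"
    by (simp add: card_permutations)
  moreover have "(\<Sum>w\<in>?W. (\<Prod>i<d. x (w i)) * symmetrize d T w)
      = (\<Sum>\<pi>\<in>?P. \<Sum>w\<in>?W. (\<Prod>i<d. x (w i)) * T (w \<circ> \<pi>)) / fact d"
    unfolding symmetrize_def
    by (subst sum.swap) (simp add: sum_distrib_left sum_divide_distrib)
  ultimately show ?thesis by simp
qed

lemma Q_cone_subset_COP: "Q_cone r \<subseteq> COP"
proof
  fix M :: "'a \<Rightarrow> 'a \<Rightarrow> real" assume "M \<in> Q_cone r"
  then obtain N S where M: "M \<in> kernels" and N: "N \<in> nonneg_tensors (r + 2)" and S: "S \<in> two_PSD r"
    and eq: "\<And>v. v \<in> tuples (r + 2) \<Longrightarrow> symmetrize (r + 2) (stk 2 (kernel_tensor M)) v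
      = symmetrize (r + 2) (\<lambda>v. N v + S v) v"
    by (auto simp: Q_cone_def symmetrize_add)
  have "0 \<le> (\<Sum>u\<in>U. \<Sum>v\<in>U. x u * M u v * x v)"
    if U: "finite U" and x: "\<And>u. u \<in> U \<Longrightarrow> 0 \<le> x u" for U and x :: "'a \<Rightarrow> real"
  \<comment> \<open>The certificate only bounds \<open>(\<Sum>u\<in>U. x u) ^ r\<close> times the
    form from below; the power must be positive to be cancelled.\<close>
  proof (cases "\<forall>u\<in>U. x u = 0")
    case False
    then obtain u where "u \<in> U" "x u \<noteq> 0" by blast
    then have "0 < (\<Sum>u\<in>U. x u)"
      using U x by (intro sum_pos2[of U u]) (auto simp: order.strict_iff_order)
    let ?W = "\<lambda>d. {..<d::nat} \<rightarrow>\<^sub>E U"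
    let ?p = "\<lambda>d w. \<Prod>i<d. x (w i)"
    have W: "w \<in> tuples d" if "w \<in> ?W d" for w d
      using that by (auto simp: PiE_def)
    have p: "0 \<le> ?p d w" if "w \<in> ?W d" for w d
      using that x by (intro prod_nonneg) auto
    \<comment> \<open>Fixing the last \<open>r\<close> coordinates leaves a quadratic form in the
      first two: a PSD slice for \<open>S\<close>, the same form for every \<open>z\<close> for
      \<open>M\<close>.\<close>
    have split: "(\<Sum>w\<in>?W (r + 2). ?p (r + 2) w * T w)
        = (\<Sum>z\<in>?W r. ?p r z * (\<Sum>u\<in>U. \<Sum>v\<in>U. x u * T (case_nat u (case_nat v z)) * x v))" for T
    proof -
      have "(\<Sum>w\<in>?W (r + 2). ?p (r + 2) w * T w)
          = (\<Sum>u\<in>U. \<Sum>v\<in>U. \<Sum>z\<in>?W r. x u * (x v * ?p r z) * T (case_nat u (case_nat v z)))"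
        by (simp add: sum_tuples_Suc prod.lessThan_Suc_shift del: prod.lessThan_Suc)
      also have "\<dots> = (\<Sum>u\<in>U. \<Sum>z\<in>?W r. \<Sum>v\<in>U. x u * (x v * ?p r z) * T (case_nat u (case_nat v z)))"
        by (intro sum.cong refl sum.swap)
      also have "\<dots> = (\<Sum>z\<in>?W r. \<Sum>u\<in>U. \<Sum>v\<in>U. x u * (x v * ?p r z) * T (case_nat u (case_nat v z)))"
        by (rule sum.swap)
      finally show ?thesis
        by (simp add: sum_distrib_left mult_ac)
    qed
    have "(\<Sum>w\<in>?W (r + 2). ?p (r + 2) w * stk 2 (kernel_tensor M) w)
        = (\<Sum>w\<in>?W (r + 2). ?p (r + 2) w * symmetrize (r + 2) (stk 2 (kernel_tensor M)) w)"
      by (rule sum_weighted_symmetrize[symmetric])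
    also have "\<dots> = (\<Sum>w\<in>?W (r + 2). ?p (r + 2) w * symmetrize (r + 2) (\<lambda>v. N v + S v) w)"
      by (intro sum.cong refl) (simp only: eq[OF W])
    also have "\<dots> = (\<Sum>w\<in>?W (r + 2). ?p (r + 2) w * N w) + (\<Sum>w\<in>?W (r + 2). ?p (r + 2) w * S w)"
      by (simp only: sum_weighted_symmetrize distrib_left sum.distrib)
    also have "\<dots> \<ge> 0"
    proof (rule add_nonneg_nonneg)
      show "0 \<le> (\<Sum>w\<in>?W (r + 2). ?p (r + 2) w * N w)"
        using N by (intro sum_nonneg mult_nonneg_nonneg p) (simp_all only: nonneg_tensors_def W mem_Collect_eq)
      have "0 \<le> (\<Sum>u\<in>U. \<Sum>v\<in>U. x u * S (case_nat u (case_nat v z)) * x v)" if "z \<in> ?W r" for z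
        using S W[OF that] U by (auto simp: two_PSD_def PSD_def psd_matrix_def)
      then show "0 \<le> (\<Sum>w\<in>?W (r + 2). ?p (r + 2) w * S w)"
        unfolding split by (intro sum_nonneg[of "?W r"] mult_nonneg_nonneg p)
    qed
    finally have "0 \<le> (\<Sum>z\<in>?W r. ?p r z * (\<Sum>u\<in>U. \<Sum>v\<in>U. x u * M u v * x v))"
      unfolding split by (simp add: stk_def kernel_tensor_def)
    also have "\<dots> = (\<Sum>u\<in>U. x u) ^ r * (\<Sum>u\<in>U. \<Sum>v\<in>U. x u * M u v * x v)"
      using prod_sum_PiE[of "{..<r}" "\<lambda>_. U" "\<lambda>_. x"] U
      by (simp add: sum_distrib_right)
    finally show ?thesis
      using zero_less_power[OF \<open>0 < (\<Sum>u\<in>U. x u)\<close>, of r] by (auto simp: zero_le_mult_iff)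
  qed simp
  then show "M \<in> COP"
    using M by (auto simp: COP_def copositive_matrix_def)
qed

subsection \<open>Attainment of the stability number\<close>

text \<open>Induction on \<open>X\<close>. If no distinct points are related, the form is a sum of
  squares and Cauchy-Schwarz applies with \<open>card X \<le> m\<close>. Otherwise the weight of one
  of two related points moves to the other, which removes a point without increasing the
  form.\<close>

lemma motzkin_straus:
  fixes y :: "'b \<Rightarrow> real"
  assumes "finite X"
    and refl: "\<And>i. i \<in> X \<Longrightarrow> P i i" and sym: "\<And>i j. P i j \<Longrightarrow> P j i"
    and indep: "\<And>S. \<lbrakk>S \<subseteq> X; \<And>i j. \<lbrakk>i \<in> S; j \<in> S; i \<noteq> j\<rbrakk> \<Longrightarrow> \<not> P i j\<rbrakk> \<Longrightarrow> card S \<le> m"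
    and "\<And>i. i \<in> X \<Longrightarrow> 0 \<le> y i"
  shows "(\<Sum>i\<in>X. y i)\<^sup>2 \<le> m * (\<Sum>i\<in>X. \<Sum>j\<in>X. of_bool (P i j) * y i * y j)"
  using assms(1,2,4,5)
proof (induction X arbitrary: y rule: finite_psubset_induct)
  case (psubset X)
  show ?case
  proof (cases "\<exists>i\<in>X. \<exists>j\<in>X. i \<noteq> j \<and> P i j")
    case False
    have "(\<Sum>j\<in>X. of_bool (P i j) * y i * y j) = (y i)\<^sup>2" if "i \<in> X" for i
    proof -
      have "(\<Sum>j\<in>X. of_bool (P i j) * y i * y j) = (\<Sum>j\<in>X. if j = i then (y i)\<^sup>2 else 0)"
        using False psubset.prems(1) that by (intro sum.cong refl) (auto simp: power2_eq_square)
      then show ?thesis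
        using psubset.hyps that by simp
    qed
    then have "(\<Sum>i\<in>X. \<Sum>j\<in>X. of_bool (P i j) * y i * y j) = (\<Sum>i\<in>X. (y i)\<^sup>2)"
      by simp
    moreover have "(\<Sum>i\<in>X. y i)\<^sup>2 \<le> card X * (\<Sum>i\<in>X. (y i)\<^sup>2)"
      using sum_squared_le_sum_of_squares[of y X] by (simp add: mult.commute)
    moreover have "card X * (\<Sum>i\<in>X. (y i)\<^sup>2) \<le> m * (\<Sum>i\<in>X. (y i)\<^sup>2)"
      using psubset.prems(2)[of X] False by (intro mult_right_mono sum_nonneg) auto
    ultimately show ?thesis by simp
  next
    case True
    define q where "q i = (\<Sum>z\<in>X. of_bool (P i z) * y z)" for i
    \<comment> \<open>The point to be removed is the one with the larger \<open>q\<close>; symmetry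
      of \<open>P\<close> allows either orientation.\<close>
    obtain i j where ij: "i \<in> X" "j \<in> X" "i \<noteq> j" "P i j" "q i \<le> q j"
      using True sym by (metis linorder_linear)
    define Z where "Z = X - {j}"
    have Z: "finite Z" "i \<in> Z" "X = insert j Z" "j \<notin> Z" "Z \<subset> X"
      using ij psubset.hyps by (auto simp: Z_def)
    \<comment> \<open>Moving the weight of \<open>j\<close> to its neighbour \<open>i\<close> changes the quadratic form by
      \<open>2 * y j * (q i - q j)\<close>: the terms quadratic in the moved weight cancel.\<close>
    define y' where "y' = y(i := y i + y j)"
    have y': "y' z = y z + y j * of_bool (z = i)" for z
      by (auto simp: y'_def)
    define s where "s i = (\<Sum>z\<in>Z. of_bool (P i z) * y z)" for i
    \<comment> \<open>\<open>q i\<close> and \<open>q j\<close> exceed \<open>s i\<close> and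
      \<open>s j\<close> by the same term \<open>y j\<close>, because \<open>P i j\<close> and
      \<open>P j j\<close> hold.\<close>
    have s_le: "s i \<le> s j"
      using ij Z sym psubset.prems(1)[of j] by (simp add: q_def s_def)
    have Pij: "P i i" "P j j" "P j i"
      using ij sym psubset.prems(1) by auto
    have inner: "(\<Sum>b\<in>Z. of_bool (P a b) * y' b) = s a + y j * of_bool (P a i)" for a
    proof -
      have "(\<Sum>b\<in>Z. of_bool (P a b) * y' b) = s a + (\<Sum>b\<in>Z. if b = i then y j * of_bool (P a i) else 0)"
        unfolding s_def sum.distrib[symmetric] by (intro sum.cong refl) (auto simp: y' algebra_simps)
      then show ?thesis using Z by simp
    qed
    have "(\<Sum>a\<in>Z. \<Sum>b\<in>Z. of_bool (P a b) * y' a * y' b) = (\<Sum>a\<in>Z. y' a * (s a + y j * of_bool (P a i)))"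
      unfolding inner[symmetric] by (simp add: sum_distrib_left mult_ac)
    also have "\<dots> = (\<Sum>a\<in>Z. y a * s a) + (\<Sum>a\<in>Z. y a * of_bool (P i a)) * y j
        + y j * (s i + y j)"
    proof -
      have "(\<Sum>a\<in>Z. y' a * (s a + y j * of_bool (P a i)))
        = (\<Sum>a\<in>Z. y a * s a + y a * of_bool (P i a) * y j + (if a = i then y j * (s i + y j) else 0))"
        using Pij sym by (intro sum.cong refl) (auto simp: y' algebra_simps of_bool_def)
      then show ?thesis
        using Z by (simp add: sum.distrib sum_distrib_right del: sum_mult_of_bool_eq)
    qed
    also have "\<dots> = (\<Sum>a\<in>Z. y a * s a) + 2 * y j * s i + (y j)\<^sup>2"
      by (simp add: s_def algebra_simps power2_eq_square)
    also have "\<dots> \<le> (\<Sum>a\<in>Z. y a * s a) + 2 * y j * s j + (y j)\<^sup>2"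
      using s_le psubset.prems(3)[OF ij(2)] by (simp add: mult_left_mono)
    also have "\<dots> = (\<Sum>a\<in>X. \<Sum>b\<in>X. of_bool (P a b) * y a * y b)"
    proof -
      have row: "(\<Sum>b\<in>X. of_bool (P a b) * y a * y b) = y a * of_bool (P j a) * y j + y a * s a" for a
      proof -
        have "of_bool (P a j) = (of_bool (P j a) :: real)"
          using sym[of a j] sym[of j a] by (auto simp: of_bool_def)
        then show ?thesis
          using Z(1,3,4) unfolding s_def sum_distrib_left by (simp add: mult_ac)
      qed
      have "(\<Sum>a\<in>X. y a * of_bool (P j a) * y j + y a * s a)
        = (y j * y j + y j * s j) + ((\<Sum>a\<in>Z. of_bool (P j a) * y a) * y j + (\<Sum>a\<in>Z. y a * s a))"
        using Z(1,3,4) Pij unfolding sum_distrib_right sum.distrib[symmetric] by (simp add: mult_ac)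
      then show ?thesis
        unfolding row s_def[symmetric] by (simp add: power2_eq_square)
    qed
    finally have le: "(\<Sum>a\<in>Z. \<Sum>b\<in>Z. of_bool (P a b) * y' a * y' b)
      \<le> (\<Sum>a\<in>X. \<Sum>b\<in>X. of_bool (P a b) * y a * y b)" .
    have "(\<Sum>a\<in>X. y a) = (\<Sum>a\<in>Z. y' a)"
      using Z by (simp add: y' sum.distrib flip: sum_distrib_left)
    then have "(\<Sum>a\<in>X. y a)\<^sup>2 = (\<Sum>a\<in>Z. y' a)\<^sup>2"
      by simp
    also have "\<dots> \<le> m * (\<Sum>a\<in>Z. \<Sum>b\<in>Z. of_bool (P a b) * y' a * y' b)"
      using psubset.prems Z ij by (intro psubset.IH) (auto simp: y')
    also have "\<dots> \<le> m * (\<Sum>a\<in>X. \<Sum>b\<in>X. of_bool (P a b) * y a * y b)"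
      using le by (intro mult_left_mono) auto
    finally show ?thesis .
  qed
qed

section \<open>Independent sets and the lower bound\<close>

lemma card_indep_le_card_cover:
  assumes "finite \<C>" "\<And>C. C \<in> \<C> \<Longrightarrow> clique C E" "S \<subseteq> \<Union>\<C>" "indep S E"
  shows "card S \<le> card \<C>"
proof -
  obtain f where f: "\<And>s. s \<in> S \<Longrightarrow> f s \<in> \<C> \<and> s \<in> f s"
  proof -
    have "\<forall>s\<in>S. \<exists>C. C \<in> \<C> \<and> s \<in> C"
      using assms(3) by blast
    then show thesis
      using that by (metis (no_types))
  qed
  have "inj_on f S"
  proof (rule inj_onI)
    fix s t assume "s \<in> S" "t \<in> S" "f s = f t"
    then show "s = t"
      using f[of s] f[of t] assms(2)[of "f s"] assms(4) unfolding clique_def indep_def by metis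
  qed
  then show ?thesis
    using f assms(1) by (intro card_inj_on_le[of f]) auto
qed

lemma clique_open_cover:
  assumes "compact_packing_graph E"
  obtains \<C> where "finite \<C>" "\<And>C. C \<in> \<C> \<Longrightarrow> clique C E" "\<Union>\<C> = UNIV"
proof -
  have "\<exists>U. open U \<and> clique U E \<and> v \<in> U" for v
    using assms unfolding compact_packing_graph_def
    by (metis clique_def finite.emptyI finite.insertI insert_subset singletonD)
  then have "UNIV \<subseteq> \<Union>{U. open U \<and> clique U E}"
    by blast
  moreover have "compact (UNIV :: 'a set)"
    using assms by (simp add: compact_packing_graph_def)
  ultimately obtain \<C> where "\<C> \<subseteq> {U. open U \<and> clique U E}" "finite \<C>" "UNIV \<subseteq> \<Union>\<C>"
    by (metis (mono_tags, lifting) compactE mem_Collect_eq)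
  then show thesis
    by (intro that[of \<C>]) auto
qed

text \<open>A finite cover by cliques bounds the size of all independent sets, so a largest one
  exists and the supremum in \<open>enat\<close> is finite.\<close>

lemma stability_number_attained:
  assumes "compact_packing_graph E"
  obtains S where "finite S" "S \<noteq> {}" "indep S E" "stability_number E = enat (card S)"
    "\<And>T. \<lbrakk>finite T; indep T E\<rbrakk> \<Longrightarrow> card T \<le> card S"
proof -
  obtain \<C> where \<C>: "finite \<C>" "\<And>C. C \<in> \<C> \<Longrightarrow> clique C E" "\<Union>\<C> = UNIV"
    using clique_open_cover[OF assms] by metis
  let ?P = "\<lambda>S. finite S \<and> indep S E"
  have "\<forall>S. ?P S \<longrightarrow> card S \<le> card \<C>"
    using card_indep_le_card_cover[OF \<C>(1,2)] \<C>(3) by blast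
  moreover have "?P {}" by simp
  ultimately obtain S where S: "?P S" and max: "\<And>T. ?P T \<Longrightarrow> card T \<le> card S"
    using ex_has_greatest_nat[of ?P "{}" card "Suc (card \<C>)"] by (auto simp: less_Suc_eq_le)
  have "indep {x} E" for x
    by (simp add: indep_def)
  then have "S \<noteq> {}"
    using max[of "{undefined}"] by auto
  moreover have "stability_number E = enat (card S)"
    unfolding stability_number_def using S max
    by (intro antisym SUP_least SUP_upper) (auto intro: SUP_upper)
  ultimately show thesis
    using S max by (intro that[of S]) auto
qed

text \<open>Testing copositivity with the all-ones vector on \<open>S\<close> yields
  \<open>0 \<le> ?n * (l - ?n)\<close>.\<close>

lemma card_indep_le_feasible:
  assumes "(K, l) \<in> feasible_pairs E COP" "finite S" "S \<noteq> {}" "indep S E"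
  shows "real (card S) \<le> l"
proof -
  let ?n = "real (card S)"
  have K: "K u v = (if u = v then l else 0) - 1" if "u \<in> S" "v \<in> S" for u v
    using assms that by (auto simp: feasible_pairs_def indep_def)
  have "0 \<le> (\<Sum>u\<in>S. \<Sum>v\<in>S. 1 * K u v * 1)"
    using assms(1,2) unfolding feasible_pairs_def COP_def copositive_matrix_def
    by (auto dest!: spec[of _ S] spec[of _ "\<lambda>_. 1"])
  also have "\<dots> = (\<Sum>u\<in>S. \<Sum>v\<in>S. (if u = v then l else 0) - 1)"
    by (intro sum.cong refl) (simp add: K)
  also have "\<dots> = ?n * (l - ?n)"
    using assms(2) by (simp add: sum_subtractf algebra_simps)
  finally show ?thesis
    using assms(2,3) by (simp add: zero_le_mult_iff card_gt_0_iff)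
qed

section \<open>Finite approximation of the graph\<close>

text \<open>An open clique \<open>U\<close> containing \<open>u\<close> and \<open>v\<close> gives
  the neighbourhood \<open>U \<times> U\<close>. With the diagonal included, repeated entries of a
  tuple count as related.\<close>

lemma open_adjacency:
  assumes "compact_packing_graph E"
  shows "open {(u, v). u = v \<or> {u, v} \<in> E}"
proof (subst open_subopen, clarify)
  fix u v :: 'a assume "u = v \<or> {u, v} \<in> E"
  then have "clique {u, v} E"
    by (auto simp: clique_def insert_commute)
  then obtain U where U: "open U" "clique U E" "{u, v} \<subseteq> U"
    using assms unfolding compact_packing_graph_def by (metis finite.emptyI finite.insertI)
  then have "open (U \<times> U)" "(u, v) \<in> U \<times> U" "U \<times> U \<subseteq> {(u, v). u = v \<or> {u, v} \<in> E}"
    by (auto simp: clique_def open_Times)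
  then show "\<exists>T. open T \<and> (u, v) \<in> T \<and> T \<subseteq> {(u, v). u = v \<or> {u, v} \<in> E}"
    by blast
qed

text \<open>
  A finite subcover of the boxes in \<open>V\<^sup>k\<close> singles out finitely many open sets; \<open>U x\<close> is the
  intersection of those which contain \<open>x\<close>.
\<close>

lemma compact_uniform_boxes:
  fixes R :: "('a::topological_space \<times> 'a) set"
  assumes "compact (UNIV :: 'a set)" "open R"
    and hit: "\<And>w :: nat \<Rightarrow> 'a. \<exists>i<k. \<exists>j<k. i \<noteq> j \<and> (w i, w j) \<in> R"
  obtains U where "\<And>x. open (U x)" "\<And>x. x \<in> U x"
    "\<And>w :: nat \<Rightarrow> 'a. \<exists>i<k. \<exists>j<k. i \<noteq> j \<and> U (w i) \<times> U (w j) \<subseteq> R"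
proof -
  let ?X = "product_topology (\<lambda>_. euclidean :: 'a topology) {..<k}"
  define \<B> where "\<B> = {(i, j, A, B). i < k \<and> j < k \<and> i \<noteq> j \<and> open A \<and> open B \<and> A \<times> B \<subseteq> R}"
  define box where "box = (\<lambda>(i::nat, j::nat, A, B). {w \<in> topspace ?X. w i \<in> A \<and> w j \<in> (B :: 'a set)})"
  have "openin ?X (box b)" if b_in: "b \<in> \<B>" for b
  proof -
    obtain i j A B where b: "b = (i, j, A, B)" "i < k" "j < k" "open A" "open B"
      using b_in unfolding \<B>_def by blast
    have "openin ?X {w \<in> topspace ?X. w l \<in> C}" if "l < k" "open C" for l C
      using that by (intro openin_continuous_map_preimage[where Y=euclidean] continuous_map_product_projection) auto
    from openin_Int[OF this[OF b(2,4)] this[OF b(3,5)]] show ?thesis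
      by (simp add: b box_def Collect_conj_eq[symmetric] conj_ac)
  qed
  moreover have "topspace ?X \<subseteq> \<Union>(box ` \<B>)"
  proof
    fix w :: "nat \<Rightarrow> 'a" assume w: "w \<in> topspace ?X"
    obtain i j where ij: "i < k" "j < k" "i \<noteq> j" "(w i, w j) \<in> R"
      using hit by blast
    obtain A B where "open A" "open B" "(w i, w j) \<in> A \<times> B" "A \<times> B \<subseteq> R"
      using open_prod_elim[OF assms(2) ij(4)] by metis
    then show "w \<in> \<Union>(box ` \<B>)"
      using ij w by (intro UN_I[of "(i, j, A, B)"]) (auto simp: \<B>_def box_def)
  qed
  moreover have "compact_space ?X"
  proof -
    have "compact_space (euclidean :: 'a topology)"
      using assms(1) by (simp add: compact_space_def)
    then show ?thesis
      by (simp add: compact_space_product_topology)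
  qed
  ultimately obtain \<F>' where "finite \<F>'" "\<F>' \<subseteq> box ` \<B>" "topspace ?X \<subseteq> \<Union>\<F>'"
    using compact_space_alt[THEN iffD1, rule_format, of ?X "box ` \<B>"] by blast
  then obtain \<F> where \<F>: "finite \<F>" "\<F> \<subseteq> \<B>" "topspace ?X \<subseteq> \<Union>(box ` \<F>)"
    by (metis finite_subset_image)
  define \<W> where "\<W> = (\<Union>(i, j, A, B)\<in>\<F>. {A, B})"
  have "open A \<and> open B" if "(i, j, A, B) \<in> \<F>" for i j A B
    using subsetD[OF \<F>(2) that] by (simp add: \<B>_def)
  then have open_W: "\<forall>W\<in>\<W>. open W"
    unfolding \<W>_def by auto
  define U where "U x = \<Inter>{W \<in> \<W>. x \<in> W}" for x
  show thesis
  proof (rule that[of U])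
    show "open (U x)" for x
      unfolding U_def
    proof (rule open_Inter)
      show "finite {W \<in> \<W>. x \<in> W}"
        using \<F>(1) by (auto simp: \<W>_def)
      show "\<forall>W\<in>{W \<in> \<W>. x \<in> W}. open W"
        using open_W by simp
    qed
    show "x \<in> U x" for x
      by (simp add: U_def)
    show "\<exists>i<k. \<exists>j<k. i \<noteq> j \<and> U (w i) \<times> U (w j) \<subseteq> R" for w
    proof -
      \<comment> \<open>The boxes consist of extensional tuples, so \<open>w\<close> is restricted
        first. The sides of a box containing it belong to \<open>\<W>\<close>, hence contain
        \<open>U (w i)\<close> and \<open>U (w j)\<close>.\<close>
      have "restrict w {..<k} \<in> topspace ?X" by simp
      then obtain b where "b \<in> \<F>" "restrict w {..<k} \<in> box b"
        using \<F>(3) by blast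
      moreover obtain i j A B where b: "b = (i, j, A, B)"
        by (cases b)
      moreover from calculation have "b \<in> \<B>"
        using \<F>(2) by blast
      ultimately have ij: "i < k" "j < k" "i \<noteq> j" "A \<times> B \<subseteq> R" "w i \<in> A" "w j \<in> B"
        unfolding \<B>_def box_def by auto
      have "A \<in> \<W>" "B \<in> \<W>"
        using \<open>b \<in> \<F>\<close> unfolding \<W>_def b by fast+
      then have "U (w i) \<subseteq> A" "U (w j) \<subseteq> B"
        unfolding U_def using ij(5,6) by (auto intro!: Inter_lower)
      then show ?thesis
        using ij by blast
    qed
  qed
qed

lemma normal_space_compact_t2:
  assumes "compact (UNIV :: 'a::t2_space set)"
  shows "normal_space (euclidean :: 'a topology)"
proof -
  have "Hausdorff_space (euclidean :: 'a topology)"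
    by (auto simp: Hausdorff_space_def disjnt_def) (metis hausdorff)
  then show ?thesis
    using assms by (intro compact_Hausdorff_or_regular_imp_normal_space) (auto simp: compact_space_def)
qed

text \<open>Urysohn functions that are \<open>1\<close> at \<open>x\<close> and \<open>0\<close>
  outside \<open>U x\<close> have open positivity sets covering the space; finitely many suffice,
  and dividing by their sum normalises.\<close>

lemma finite_subordinate_partition:
  fixes U :: "'a::t2_space \<Rightarrow> 'a set"
  assumes "compact (UNIV :: 'a set)" "\<And>x. open (U x)" "\<And>x. x \<in> U x"
  obtains X and p :: "'a \<Rightarrow> 'a \<Rightarrow> real" where "finite X" "\<And>x. continuous_on UNIV (p x)"
    "\<And>x u. 0 \<le> p x u" "\<And>x u. u \<notin> U x \<Longrightarrow> p x u = 0" "\<And>u. (\<Sum>x\<in>X. p x u) = 1"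
proof -
  have "\<exists>g. continuous_on UNIV g \<and> (\<forall>u. 0 \<le> g u) \<and> (\<forall>u. u \<notin> U x \<longrightarrow> g u = 0) \<and> g x = (1::real)" for x
  proof -
    obtain g where "continuous_map euclidean (top_of_set {0..1::real}) g" "g ` (- U x) \<subseteq> {0}" "g ` {x} \<subseteq> {1}"
      using Urysohn_lemma[OF normal_space_compact_t2[OF assms(1)], of "- U x" "{x}" 0 1] assms(2,3)
      by (auto simp: disjnt_def closed_Compl)
    then show ?thesis
      by (intro exI[of _ g]) (auto simp: continuous_map_in_subtopology image_subset_iff)
  qed
  then obtain g where g: "\<And>x. continuous_on UNIV (g x)" "\<And>x u. 0 \<le> g x u"
    "\<And>x u. u \<notin> U x \<Longrightarrow> g x u = 0" "\<And>x. g x x = (1::real)"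
    by metis
  have "open {u. 0 < g x u}" for x
    using g(1) by (intro open_Collect_less) auto
  moreover have "UNIV \<subseteq> (\<Union>x\<in>UNIV. {u. 0 < g x u})"
    using g(4) by (auto intro: exI[of _ "_ :: 'a"] simp: less_eq_real_def)
  ultimately obtain X where X: "finite X" "UNIV \<subseteq> (\<Union>x\<in>X. {u. 0 < g x u})"
    using compactE_image[OF assms(1), of UNIV "\<lambda>x. {u. 0 < g x u}"] by metis
  define G where "G u = (\<Sum>x\<in>X. g x u)" for u
  have G: "0 < G u" for u
  proof -
    obtain x where "x \<in> X" "0 < g x u"
      using X(2) by blast
    then show ?thesis
      unfolding G_def using X(1) g(2) by (intro sum_pos2[of X x]) auto
  qed
  have "continuous_on UNIV G"
    unfolding G_def by (intro continuous_on_sum g)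
  moreover have "G u \<noteq> 0" for u
    using G[of u] by simp
  ultimately show thesis
    using X G g
    by (intro that[of X "\<lambda>x u. g x u / G u"])
      (auto intro!: continuous_on_divide divide_nonneg_pos simp: G_def[symmetric]
        simp flip: sum_divide_distrib)
qed

text \<open>Spreading the weights \<open>x\<close> over \<open>X\<close> through \<open>p\<close>
  turns the form of the kernel on \<open>W\<close> into that of the matrix \<open>c\<close> on
  \<open>X\<close>.\<close>

lemma quadratic_form_expand:
  fixes x :: "'a \<Rightarrow> real" and p :: "'b \<Rightarrow> 'a \<Rightarrow> real"
  shows "(\<Sum>u\<in>W. \<Sum>v\<in>W. x u * (\<Sum>a\<in>X. \<Sum>b\<in>X. c a b * p a u * p b v) * x v)
    = (\<Sum>a\<in>X. \<Sum>b\<in>X. c a b * (\<Sum>u\<in>W. x u * p a u) * (\<Sum>v\<in>W. x v * p b v))"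
proof -
  have "(\<Sum>u\<in>W. \<Sum>v\<in>W. x u * (\<Sum>a\<in>X. \<Sum>b\<in>X. c a b * p a u * p b v) * x v)
    = (\<Sum>(u, v)\<in>W \<times> W. \<Sum>(a, b)\<in>X \<times> X. c a b * (x u * p a u) * (x v * p b v))"
    by (simp add: sum_distrib_left sum_distrib_right sum.cartesian_product[symmetric] mult_ac)
  also have "\<dots> = (\<Sum>(a, b)\<in>X \<times> X. \<Sum>(u, v)\<in>W \<times> W. c a b * (x u * p a u) * (x v * p b v))"
    unfolding case_prod_beta by (rule sum.swap)
  also have "\<dots> = (\<Sum>a\<in>X. \<Sum>b\<in>X. c a b * (\<Sum>u\<in>W. x u * p a u) * (\<Sum>v\<in>W. x v * p b v))"
    by (simp add: sum_distrib_left sum_distrib_right sum.cartesian_product[symmetric] mult_ac)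
  finally show ?thesis .
qed

lemma stability_number_feasible:
  assumes G: "compact_packing_graph E"
    and m: "0 < m" "\<And>T. \<lbrakk>finite T; indep T E\<rbrakk> \<Longrightarrow> card T \<le> m"
  obtains K where "(K, real m) \<in> feasible_pairs E COP"
proof -
  let ?R = "{(u, v). u = v \<or> {u, v} \<in> E}"
  have cpt: "compact (UNIV :: 'a set)"
    using G by (simp add: compact_packing_graph_def)
  have R: "open ?R"
    by (rule open_adjacency[OF G])
  \<comment> \<open>Of \<open>Suc m\<close> points, two coincide or the set is too large to be
    independent.\<close>
  have hit: "\<exists>i<Suc m. \<exists>j<Suc m. i \<noteq> j \<and> (w i, w j) \<in> ?R" for w :: "nat \<Rightarrow> 'a"
  proof (cases "inj_on w {..<Suc m}")
    case True
    then have "card (w ` {..<Suc m}) = Suc m"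
      by (simp add: card_image)
    then have "\<not> indep (w ` {..<Suc m}) E"
      using m(2)[of "w ` {..<Suc m}"] by auto
    then show ?thesis
      unfolding indep_def by auto
  qed (auto simp: inj_on_def)
  obtain U where U: "\<And>x. open (U x)" "\<And>x. x \<in> U x"
    "\<And>w :: nat \<Rightarrow> 'a. \<exists>i<Suc m. \<exists>j<Suc m. i \<noteq> j \<and> U (w i) \<times> U (w j) \<subseteq> ?R"
    by (rule compact_uniform_boxes[OF cpt R hit]) (rule that)
  obtain X and p :: "'a \<Rightarrow> 'a \<Rightarrow> real" where X: "finite X" and p: "\<And>x. continuous_on UNIV (p x)"
    "\<And>x u. 0 \<le> p x u" "\<And>x u. u \<notin> U x \<Longrightarrow> p x u = 0" "\<And>u. (\<Sum>x\<in>X. p x u) = 1"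
    using finite_subordinate_partition[OF cpt, of U] U(1,2) by metis
  define P where "P x y \<longleftrightarrow> U x \<times> U y \<subseteq> ?R" for x y
  have hit_P: "\<exists>i<Suc m. \<exists>j<Suc m. i \<noteq> j \<and> P (w i) (w j)" for w
    unfolding P_def by (rule U(3))
  \<comment> \<open>On a constant tuple, \<open>hit_P\<close> relates a point to itself.\<close>
  have P_refl: "P x x" for x
    using hit_P[of "\<lambda>_. x"] by blast
  have P_sym: "P y x" if "P x y" for x y
    using that by (auto simp: P_def insert_commute)
  have P_indep: "card T \<le> m" if T: "T \<subseteq> X" "\<And>i j. \<lbrakk>i \<in> T; j \<in> T; i \<noteq> j\<rbrakk> \<Longrightarrow> \<not> P i j" for T
  proof (rule ccontr)
    assume "\<not> card T \<le> m"
    \<comment> \<open>The first \<open>Suc m\<close> entries of this enumeration are distinct points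
      of \<open>T\<close>, and \<open>hit_P\<close> relates two of them.\<close>
    obtain w where w: "bij_betw w {0..<card T} T"
      using ex_bij_betw_nat_finite finite_subset[OF T(1) X] by blast
    obtain i j where ij: "i < Suc m" "j < Suc m" "i \<noteq> j" "P (w i) (w j)"
      using hit_P[of w] by blast
    have ij_T: "i \<in> {0..<card T}" "j \<in> {0..<card T}"
      using ij(1,2) \<open>\<not> card T \<le> m\<close> by simp_all
    then have "w i \<noteq> w j"
      using ij(3) bij_betw_imp_inj_on[OF w] by (simp add: inj_on_eq_iff)
    then show False
      using T(2)[OF bij_betwE[OF w, rule_format, OF ij_T(1)] bij_betwE[OF w, rule_format, OF ij_T(2)]] ij(4)
      by simp
  qed
  define F where "F u v = (\<Sum>x\<in>X. \<Sum>y\<in>X. of_bool (P x y) * p x u * p y v)" for u v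
  have F_cont: "continuous_on UNIV (\<lambda>z. F (f z) (g z))"
    if "continuous_on UNIV f" "continuous_on UNIV g" for f g :: "'a \<times> 'a \<Rightarrow> 'a"
    unfolding F_def using that
    by (intro continuous_intros continuous_on_compose2[OF p(1)]) auto
  have F_sym: "F u v = F v u" for u v
  proof -
    have "P x y = P y x" for x y using P_sym by blast
    then show ?thesis unfolding F_def by (subst sum.swap) (simp add: mult_ac)
  qed
  \<comment> \<open>A nonzero term would place \<open>(u, v)\<close> in
    \<open>U x \<times> U y\<close>, which lies in \<open>?R\<close> when \<open>P x y\<close>
    holds.\<close>
  have F_nonadj: "F u v = 0" if "(u, v) \<notin> ?R" for u v
  proof -
    have "of_bool (P x y) * p x u * p y v = 0" for x y
      using that p(3)[of u x] p(3)[of v y] by (auto simp: P_def)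
    then show ?thesis unfolding F_def by (intro sum.neutral ballI)
  qed
  have F_diag: "F u u \<le> 1" for u
  proof -
    have "F u u \<le> (\<Sum>x\<in>X. \<Sum>y\<in>X. p x u * p y u)"
      unfolding F_def using p(2) by (intro sum_mono) (auto simp: of_bool_def)
    also have "\<dots> = 1"
      using p(4)[of u] by (simp flip: sum_product)
    finally show ?thesis .
  qed
  have "compact (UNIV :: ('a \<times> 'a) set)"
    using compact_Times[OF cpt cpt] by simp
  moreover have "closed {(u, v). u = (v :: 'a)}"
  proof -
    have "{(u, v). u = (v :: 'a)} = {z. \<exists>x. z = (x, x)}"
      by auto
    then show ?thesis
      by (simp add: closed_diagonal)
  qed
  \<comment> \<open>The complement of \<open>?R\<close> and the diagonal are disjoint closed sets.
    The cutoff \<open>h\<close> keeps the diagonal correction off nonadjacent pairs; it need not be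
    symmetric, hence the product \<open>h (u, v) * h (v, u)\<close> below.\<close>
  ultimately obtain h where h: "continuous_map euclidean (top_of_set {0..1::real}) h" "h ` (- ?R) \<subseteq> {0}"
      "h ` {(u, v). u = v} \<subseteq> {1}"
    using R Urysohn_lemma[OF normal_space_compact_t2, of "- ?R" "{(u, v). u = v}" 0 1]
    by (auto simp: disjnt_def)
  have h_cont: "continuous_on UNIV h" and h01: "0 \<le> h z" for z
    using h(1) by (auto simp: continuous_map_in_subtopology image_subset_iff)
  have h_diag: "h (u, u) = 1" for u
    using h(3) by auto
  have h_nonadj: "h (u, v) = 0" if "(u, v) \<notin> ?R" for u v
  proof -
    have "(u, v) \<in> - ?R"
      using that by simp
    then show ?thesis
      by (rule singletonD[OF subsetD[OF h(2) imageI]])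
  qed
  \<comment> \<open>\<open>F\<close> already has a sufficiently large form, but \<open>F u u \<le> 1\<close> may be strict; the
    nonnegative correction \<open>B\<close> makes the diagonal equal to \<open>1\<close>.\<close>
  define B where "B u v = h (u, v) * h (v, u) * (1 - (F u u + F v v) / 2)" for u v
  define K where "K u v = real m * (F u v + B u v) - 1" for u v
  have B_nonneg: "0 \<le> B u v" for u v
    unfolding B_def using F_diag[of u] F_diag[of v] by (intro mult_nonneg_nonneg h01) simp
  have "continuous_on UNIV (\<lambda>(u, v). K u v)"
    unfolding K_def B_def case_prod_beta
    by (intro continuous_intros F_cont continuous_on_compose2[OF h_cont]) auto
  moreover have "K u v = K v u" for u v
    using F_sym[of u v] by (simp add: K_def B_def mult_ac add_ac)
  ultimately have kernel: "K \<in> kernels"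
    by (auto simp: kernels_def)
  have "0 \<le> (\<Sum>u\<in>W. \<Sum>v\<in>W. x u * K u v * x v)"
    if "finite W" and x: "\<And>u. u \<in> W \<Longrightarrow> 0 \<le> x u" for W and x :: "'a \<Rightarrow> real"
  proof -
    \<comment> \<open>Weights pushed onto the finite graph; their total is unchanged because the
      functions \<open>p a\<close> sum to \<open>1\<close>.\<close>
    define y where "y a = (\<Sum>u\<in>W. x u * p a u)" for a
    have "(\<Sum>a\<in>X. y a) = (\<Sum>u\<in>W. x u)"
      unfolding y_def by (subst sum.swap) (simp add: p(4) flip: sum_distrib_left)
    then have "(\<Sum>u\<in>W. x u)\<^sup>2 = (\<Sum>a\<in>X. y a)\<^sup>2"
      by simp
    also have "\<dots> \<le> m * (\<Sum>a\<in>X. \<Sum>b\<in>X. of_bool (P a b) * y a * y b)"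
      using X P_refl P_sym P_indep
      by (rule motzkin_straus) (auto simp: y_def intro!: sum_nonneg mult_nonneg_nonneg x p(2))
    also have "\<dots> = m * (\<Sum>u\<in>W. \<Sum>v\<in>W. x u * F u v * x v)"
      unfolding y_def F_def quadratic_form_expand ..
    also have "\<dots> \<le> m * (\<Sum>u\<in>W. \<Sum>v\<in>W. x u * (F u v + B u v) * x v)"
      using x B_nonneg by (intro mult_left_mono sum_mono mult_right_mono) auto
    finally have "(\<Sum>u\<in>W. x u)\<^sup>2 \<le> m * (\<Sum>u\<in>W. \<Sum>v\<in>W. x u * (F u v + B u v) * x v)" .
    moreover have "(\<Sum>u\<in>W. x u)\<^sup>2 = (\<Sum>u\<in>W. \<Sum>v\<in>W. x u * x v)"
      by (simp add: power2_eq_square sum_product)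
    moreover have "(\<Sum>u\<in>W. \<Sum>v\<in>W. x u * K u v * x v)
      = m * (\<Sum>u\<in>W. \<Sum>v\<in>W. x u * (F u v + B u v) * x v) - (\<Sum>u\<in>W. \<Sum>v\<in>W. x u * x v)"
      unfolding K_def by (simp add: sum_distrib_left algebra_simps flip: sum_subtractf)
    ultimately show ?thesis by linarith
  qed
  then have "K \<in> COP"
    using kernel by (auto simp: COP_def copositive_matrix_def)
  moreover have "K v v = real m - 1" for v
    by (simp add: K_def B_def h_diag)
  moreover have "K u v = - 1" if "u \<noteq> v" "{u, v} \<notin> E" for u v
    using that F_nonadj[of u v] h_nonadj[of u v] by (simp add: K_def B_def)
  ultimately show thesis
    using kernel by (intro that[of K]) (simp add: feasible_pairs_def)
qed

subsection \<open>Strictly copositive kernels\<close>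

text \<open>Double counting over ordered pairs of distinct positions: the sum over permutations is
  the same for every pair, and for a fixed permutation the sum over pairs is merely
  rearranged.\<close>

lemma sum_permutes_pair:
  fixes g :: "nat \<Rightarrow> nat \<Rightarrow> real"
  assumes "2 \<le> n"
  shows "real (n * (n - 1)) * (\<Sum>\<pi> | \<pi> permutes {..<n}. g (\<pi> 0) (\<pi> 1))
    = fact n * (\<Sum>i<n. \<Sum>j\<in>{..<n} - {i}. g i j)"
proof -
  let ?P = "{\<pi>. \<pi> permutes {..<n}}"
  have indep: "(\<Sum>\<pi>\<in>?P. g (\<pi> a) (\<pi> b)) = (\<Sum>\<pi>\<in>?P. g (\<pi> 0) (\<pi> 1))"
    if ab: "a < n" "b < n" "a \<noteq> b" for a b
  proof -
    \<comment> \<open>\<open>c\<close> is the preimage of \<open>b\<close> under the transposition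
      of \<open>0\<close> and \<open>a\<close>, so that \<open>\<rho>\<close> sends \<open>0\<close>
      to \<open>a\<close> and \<open>1\<close> to \<open>b\<close>; \<open>c \<noteq> 0\<close>
      because \<open>a \<noteq> b\<close>.\<close>
    define c where "c = Transposition.transpose 0 a b"
    have c: "c \<noteq> 0" "c < n" "Transposition.transpose 0 a c = b"
      using ab by (auto simp: c_def Transposition.transpose_def)
    define \<rho> where "\<rho> = Transposition.transpose 0 a \<circ> Transposition.transpose 1 c"
    have \<rho>: "\<rho> permutes {..<n}"
      unfolding \<rho>_def using ab c assms by (intro permutes_compose permutes_swap_id) auto
    have "\<rho> 0 = a" "\<rho> 1 = b"
      using c by (auto simp: \<rho>_def Transposition.transpose_def)
    then show ?thesis
      using sum_permutations_compose_right[OF \<rho>, of "\<lambda>\<pi>. g (\<pi> 0) (\<pi> 1)"] by simp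
  qed
  have "(\<Sum>i<n. \<Sum>j\<in>{..<n} - {i}. \<Sum>\<pi>\<in>?P. g (\<pi> i) (\<pi> j))
      = (\<Sum>i<n. \<Sum>j\<in>{..<n} - {i}. \<Sum>\<pi>\<in>?P. g (\<pi> 0) (\<pi> 1))"
    by (intro sum.cong[OF refl] indep) auto
  then have "(\<Sum>i<n. \<Sum>j\<in>{..<n} - {i}. \<Sum>\<pi>\<in>?P. g (\<pi> i) (\<pi> j))
      = real (n * (n - 1)) * (\<Sum>\<pi>\<in>?P. g (\<pi> 0) (\<pi> 1))"
    using assms by (simp add: of_nat_diff)
  moreover have "(\<Sum>i<n. \<Sum>j\<in>{..<n} - {i}. \<Sum>\<pi>\<in>?P. g (\<pi> i) (\<pi> j))
      = (\<Sum>\<pi>\<in>?P. \<Sum>i<n. \<Sum>j\<in>{..<n} - {i}. g (\<pi> i) (\<pi> j))"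
  proof -
    have "(\<Sum>i<n. \<Sum>j\<in>{..<n} - {i}. \<Sum>\<pi>\<in>?P. g (\<pi> i) (\<pi> j))
        = (\<Sum>i<n. \<Sum>\<pi>\<in>?P. \<Sum>j\<in>{..<n} - {i}. g (\<pi> i) (\<pi> j))"
      by (intro sum.cong refl sum.swap)
    also have "\<dots> = (\<Sum>\<pi>\<in>?P. \<Sum>i<n. \<Sum>j\<in>{..<n} - {i}. g (\<pi> i) (\<pi> j))"
      by (rule sum.swap)
    finally show ?thesis .
  qed
  moreover have "(\<Sum>i<n. \<Sum>j\<in>{..<n} - {i}. g (\<pi> i) (\<pi> j)) = (\<Sum>i<n. \<Sum>j\<in>{..<n} - {i}. g i j)"
    if \<pi>: "\<pi> \<in> ?P" for \<pi>
  proof -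
    have *: "(\<Sum>i<n. \<Sum>j\<in>{..<n} - {i}. g (f i) (f j)) = (\<Sum>i<n. \<Sum>j<n. if i = j then 0 else g (f i) (f j))" for f
      by (intro sum.cong refl sum.mono_neutral_cong_left) auto
    have inj: "i = j \<longleftrightarrow> \<pi> i = \<pi> j" for i j
      using \<pi> by (auto dest: permutes_inj injD)
    have "(\<Sum>i<n. \<Sum>j<n. if \<pi> i = \<pi> j then 0 else g (\<pi> i) (\<pi> j)) = (\<Sum>i<n. \<Sum>j<n. if i = j then 0 else g i j)"
      using \<pi> sum.permute[of \<pi> "{..<n}" "\<lambda>i. \<Sum>j<n. if i = \<pi> j then 0 else g i (\<pi> j)"]
        sum.permute[of \<pi> "{..<n}" "\<lambda>j. if _ = j then 0 else g _ j"]
      by (simp add: o_def)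
    then show ?thesis
      using *[of \<pi>] *[of "\<lambda>i. i"] inj by simp
  qed
  ultimately show ?thesis
    by (simp add: card_permutations)
qed

text \<open>The hypothesis concerns finite sets while a tuple may repeat entries; multiplicities
  serve as weights, with total \<open>n\<close>.\<close>

lemma copositive_tuple_sum:
  fixes M :: "'a \<Rightarrow> 'a \<Rightarrow> real" and v :: "nat \<Rightarrow> 'a"
  assumes "\<And>U x. \<lbrakk>finite U; \<And>u. u \<in> U \<Longrightarrow> 0 \<le> x u\<rbrakk> \<Longrightarrow>
    \<delta> * (\<Sum>u\<in>U. x u)\<^sup>2 \<le> (\<Sum>u\<in>U. \<Sum>v\<in>U. x u * M u v * x v)"
  shows "\<delta> * (real n)\<^sup>2 \<le> (\<Sum>i<n. \<Sum>j<n. M (v i) (v j))"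
proof -
  let ?U = "v ` {..<n}"
  define x where "x u = real (card {i\<in>{..<n}. v i = u})" for u
  have group: "(\<Sum>i<n. f (v i)) = (\<Sum>u\<in>?U. x u * f u)" for f :: "'a \<Rightarrow> real"
    using sum.image_gen[of "{..<n}" "\<lambda>i. f (v i)" v] by (simp add: x_def)
  have "(\<Sum>u\<in>?U. x u) = real n"
    using group[of "\<lambda>_. 1"] by simp
  then have "\<delta> * (real n)\<^sup>2 \<le> (\<Sum>u\<in>?U. \<Sum>w\<in>?U. x u * M u w * x w)"
    using assms[of ?U x] by (simp add: x_def)
  also have "\<dots> = (\<Sum>i<n. \<Sum>j<n. M (v i) (v j))"
    unfolding group group[of "\<lambda>u. \<Sum>w\<in>?U. x w * M u w"] by (simp add: sum_distrib_left mult_ac)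
  finally show ?thesis .
qed

text \<open>
  The Polya argument: at \<open>v\<close> the symmetrized stack is the mean of \<open>M (v i) (v j)\<close> over \<open>i \<noteq> j\<close>,
  and the diagonal terms are negligible against the \<open>\<delta> * n\<^sup>2\<close> of the full double sum.
\<close>

lemma strictly_copositive_in_C_cone:
  fixes M :: "'a::topological_space \<Rightarrow> 'a \<Rightarrow> real"
  assumes "M \<in> kernels" "0 < \<delta>" and diag: "\<And>u. M u u \<le> b"
    and cop: "\<And>U x. \<lbrakk>finite U; \<And>u. u \<in> U \<Longrightarrow> 0 \<le> x u\<rbrakk> \<Longrightarrow>
      \<delta> * (\<Sum>u\<in>U. x u)\<^sup>2 \<le> (\<Sum>u\<in>U. \<Sum>v\<in>U. x u * M u v * x v)"
  obtains r where "M \<in> C_cone r"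
proof -
  \<comment> \<open>This size gives \<open>b \<le> \<delta> * n\<close>, so the diagonal sum, at
    most \<open>b * n\<close>, stays below \<open>\<delta> * n\<^sup>2\<close>.\<close>
  obtain r where r: "b / \<delta> \<le> real r"
    using real_arch_simple by blast
  define n where "n = r + 2"
  have n: "2 \<le> n" "b \<le> \<delta> * real n"
    using r assms(2) by (auto simp: n_def field_simps intro: order_trans)
  let ?T = "stk 2 (kernel_tensor M)"
  have "0 \<le> symmetrize n ?T v" for v
  proof -
    have "b * real n \<le> \<delta> * (real n)\<^sup>2"
      using n by (simp add: power2_eq_square mult_right_mono flip: mult.assoc)
    also have "\<dots> \<le> (\<Sum>i<n. \<Sum>j<n. M (v i) (v j))"
      by (rule copositive_tuple_sum[OF cop])
    also have "\<dots> = (\<Sum>i<n. M (v i) (v i)) + (\<Sum>i<n. \<Sum>j\<in>{..<n} - {i}. M (v i) (v j))"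
      unfolding sum.distrib[symmetric] by (intro sum.cong refl sum.remove) auto
    also have "(\<Sum>i<n. M (v i) (v i)) \<le> b * real n"
      using sum_mono[of "{..<n}" "\<lambda>i. M (v i) (v i)" "\<lambda>_. b"] diag by (simp add: mult.commute)
    finally have "0 \<le> (\<Sum>i<n. \<Sum>j\<in>{..<n} - {i}. M (v i) (v j))"
      by simp
    then have "0 \<le> real (n * (n - 1)) * (\<Sum>\<pi> | \<pi> permutes {..<n}. M (v (\<pi> 0)) (v (\<pi> 1)))"
      unfolding sum_permutes_pair[OF n(1), of "\<lambda>i j. M (v i) (v j)"] by simp
    moreover have "0 < real (n * (n - 1))"
      using n(1) by simp
    ultimately have "0 \<le> (\<Sum>\<pi> | \<pi> permutes {..<n}. M (v (\<pi> 0)) (v (\<pi> 1)))"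
      by (simp only: zero_le_mult_iff) linarith
    then show ?thesis
      by (simp add: symmetrize_def stk_def kernel_tensor_def)
  qed
  \<comment> \<open>The symmetrized stack is its own nonnegative certificate, by
    idempotence.\<close>
  then have "symmetrize n ?T \<in> nonneg_tensors n"
    by (simp add: nonneg_tensors_def)
  moreover have "symmetrize n ?T v = symmetrize n (symmetrize n ?T) v" if "v \<in> tuples n" for v
    using symmetrize_idem[OF that] by simp
  ultimately have "M \<in> C_cone r"
    using assms(1) unfolding C_cone_def n_def by blast
  then show thesis by (rule that)
qed

text \<open>Subtracting a small constant stays in a ball around \<open>K\<close>. The constant
  kernel \<open>\<delta>\<close> has form \<open>\<delta> * (\<Sum>u\<in>U. x u)\<^sup>2\<close>, so
  this is a uniform lower bound on the form of \<open>K\<close>.\<close>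

lemma interior_COP_shift:
  fixes K :: "'a::topological_space \<Rightarrow> 'a \<Rightarrow> real"
  assumes "compact (UNIV :: 'a set)" "K \<in> kernel_topology interior_of COP"
  obtains \<delta> where "0 < \<delta>" "(\<lambda>u v. K u v - \<delta>) \<in> COP"
proof -
  interpret Metric_space "kernels :: ('a \<Rightarrow> 'a \<Rightarrow> real) set" kernel_dist
    by (rule Metric_space_kernels[OF assms(1)])
  obtain \<epsilon> where \<epsilon>: "0 < \<epsilon>" "mball K \<epsilon> \<subseteq> COP" and K: "K \<in> kernels"
    using assms(2) unfolding kernel_topology_def in_interior_of_mball by auto
  define \<delta> where "\<delta> = \<epsilon> / 2"
  let ?L = "\<lambda>u v. K u v - \<delta>"
  have L: "?L \<in> kernels"
    using K by (auto simp: kernels_def case_prod_beta intro!: continuous_intros)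
  have "kernel_dist K ?L = \<delta>"
    using kernel_dist_eq[OF assms(1) K L] \<epsilon>(1) by (simp add: \<delta>_def case_prod_beta)
  then have "?L \<in> mball K \<epsilon>"
    using K L \<epsilon>(1) by (simp add: \<delta>_def)
  then show thesis
    using \<epsilon> by (intro that[of \<delta>]) (auto simp: \<delta>_def)
qed

subsection \<open>Convergence\<close>

lemma feasible_pairs_mono: "A \<subseteq> B \<Longrightarrow> feasible_pairs E A \<subseteq> feasible_pairs E B"
  by (auto simp: feasible_pairs_def)

lemma optimal_value_antimono: "A \<subseteq> B \<Longrightarrow> optimal_value E B \<le> optimal_value E A"
  unfolding optimal_value_def by (intro INF_superset_mono feasible_pairs_mono) auto

lemma near_optimal_in_C_cone:
  fixes E :: "'a::t2_space set set"
  assumes G: "compact_packing_graph E" and "strictly_feasible E"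
    and K0: "(K0, l0) \<in> feasible_pairs E COP" and "l0 < c"
  obtains r K l where "(K, l) \<in> feasible_pairs E (C_cone r)" "l < c"
proof -
  obtain K1 l1 where K1: "(K1, l1) \<in> feasible_pairs E COP" and int: "K1 \<in> kernel_topology interior_of COP"
    using assms(2) by (auto simp: strictly_feasible_def)
  have cpt: "compact (UNIV :: 'a set)"
    using G by (simp add: compact_packing_graph_def)
  obtain \<delta> where \<delta>: "0 < \<delta>" "(\<lambda>u v. K1 u v - \<delta>) \<in> COP"
    using interior_COP_shift[OF cpt int] by metis
  obtain t where t: "0 < t" "t < 1" "(1 - t) * l0 + t * l1 < c"
  proof -
    \<comment> \<open>\<open>d\<close> is positive and bounds \<open>l1 - l0\<close> in either order
      of the two values, so mixing adds at most half the gap \<open>c - l0\<close>; the cap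
      \<open>1/2\<close> keeps \<open>t < 1\<close>.\<close>
    define d where "d = \<bar>l1 - l0\<bar> + 1"
    define t where "t = min (1/2) ((c - l0) / (2 * d))"
    have d: "0 < d" "l1 - l0 \<le> d"
      by (auto simp: d_def)
    have t: "0 < t" "t < 1" "t \<le> (c - l0) / (2 * d)"
      using assms(4) d by (auto simp: t_def)
    have "t * (l1 - l0) \<le> t * d"
      using t d by (intro mult_left_mono) auto
    also have "\<dots> \<le> (c - l0) / 2"
      using t(3) d(1) by (simp add: field_simps)
    also have "\<dots> < c - l0"
      using assms(4) by simp
    finally show thesis
      using t by (intro that[of t]) (auto simp: algebra_simps)
  qed
  define K where "K u v = (1 - t) * K0 u v + t * K1 u v" for u v
  define l where "l = (1 - t) * l0 + t * l1"
  have kernel: "K \<in> kernels"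
    using K0 K1 unfolding feasible_pairs_def kernels_def K_def
    by (auto simp: case_prod_beta intro!: continuous_intros)
  have diag: "K u u = l - 1" for u
  proof -
    have *: "K0 u u = l0 - 1" "K1 u u = l1 - 1"
      using K0 K1 by (auto simp: feasible_pairs_def)
    show ?thesis
      unfolding K_def l_def * by (simp add: algebra_simps)
  qed
  have nonadj: "K u v = - 1" if "u \<noteq> v" "{u, v} \<notin> E" for u v
    using K0 K1 that by (simp add: feasible_pairs_def K_def)
  \<comment> \<open>The strict bound comes from \<open>t * K1\<close>; the part from
    \<open>K0\<close> is nonnegative.\<close>
  have "t * \<delta> * (\<Sum>u\<in>U. x u)\<^sup>2 \<le> (\<Sum>u\<in>U. \<Sum>v\<in>U. x u * K u v * x v)"
    if U: "finite U" and x: "\<And>u. u \<in> U \<Longrightarrow> 0 \<le> x u" for U and x :: "'a \<Rightarrow> real"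
  proof -
    have "0 \<le> (\<Sum>u\<in>U. \<Sum>v\<in>U. x u * K0 u v * x v)"
      using K0 U x by (auto simp: feasible_pairs_def COP_def copositive_matrix_def)
    moreover have "0 \<le> (\<Sum>u\<in>U. \<Sum>v\<in>U. x u * (K1 u v - \<delta>) * x v)"
      using \<delta>(2) U x by (auto simp: COP_def copositive_matrix_def)
    ultimately have "0 \<le> (1 - t) * (\<Sum>u\<in>U. \<Sum>v\<in>U. x u * K0 u v * x v)
        + t * (\<Sum>u\<in>U. \<Sum>v\<in>U. x u * (K1 u v - \<delta>) * x v)"
      using t by simp
    also have "\<dots> = (\<Sum>u\<in>U. \<Sum>v\<in>U. x u * K u v * x v) - t * \<delta> * (\<Sum>u\<in>U. x u)\<^sup>2"
      unfolding K_def power2_eq_square sum_product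
      by (simp add: sum_distrib_left algebra_simps flip: sum.distrib sum_subtractf)
    finally show ?thesis by simp
  qed
  then obtain r where "K \<in> C_cone r"
    using strictly_copositive_in_C_cone[OF kernel, of "t * \<delta>" "l - 1"] t \<delta>(1) diag by auto
  then show thesis
    using kernel diag nonadj t(3) by (intro that[of K l r]) (auto simp: feasible_pairs_def l_def)
qed

theorem theorem3:
  fixes E :: "'a::t2_space set set"
  assumes "compact_packing_graph E"
    and "strictly_feasible E"
  shows "decseq (gamma_bound E) \<and>
         gamma_bound E \<longlonglongrightarrow> ereal_of_enat (stability_number E) \<and>
         decseq (nu_bound E) \<and>
         nu_bound E \<longlonglongrightarrow> ereal_of_enat (stability_number E)"
proof -
  obtain S where S: "finite S" "S \<noteq> {}" "indep S E" "stability_number E = enat (card S)"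
    "\<And>T. \<lbrakk>finite T; indep T E\<rbrakk> \<Longrightarrow> card T \<le> card S"
    using stability_number_attained[OF assms(1)] by metis
  let ?\<alpha> = "ereal_of_enat (stability_number E)"
  have \<alpha>: "?\<alpha> = ereal (real (card S))"
    using S(4) by simp
  have dec: "decseq (gamma_bound E)" "decseq (nu_bound E)"
    unfolding gamma_bound_def nu_bound_def
    by (auto intro!: decseq_SucI optimal_value_antimono C_cone_Suc Q_cone_Suc)
  have nu_le: "nu_bound E r \<le> gamma_bound E r" for r
    unfolding gamma_bound_def nu_bound_def by (intro optimal_value_antimono C_cone_subset_Q_cone)
  have le_nu: "?\<alpha> \<le> nu_bound E r" for r
  proof -
    have "real (card S) \<le> l" if "(K, l) \<in> feasible_pairs E (Q_cone r)" for K l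
      using that feasible_pairs_mono[OF Q_cone_subset_COP] card_indep_le_feasible[OF _ S(1-3)] by blast
    then show ?thesis
      unfolding \<alpha> nu_bound_def optimal_value_def by (intro INF_greatest) auto
  qed
  have small: "\<exists>r. gamma_bound E r < a" if less: "?\<alpha> < a" for a
  proof -
    \<comment> \<open>A real number in between is chosen because \<open>a\<close> may be
      infinite.\<close>
    obtain c where c: "real (card S) < c" "ereal c < a"
      using ereal_dense2[OF less] by (auto simp: \<alpha>)
    obtain K0 where "(K0, real (card S)) \<in> feasible_pairs E COP"
      using stability_number_feasible[OF assms(1), of "card S"] S by (auto simp: card_gt_0_iff)
    then obtain r K l where "(K, l) \<in> feasible_pairs E (C_cone r)" "l < c"
      using near_optimal_in_C_cone[OF assms] c(1) by metis
    then have "gamma_bound E r \<le> ereal c"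
      unfolding gamma_bound_def optimal_value_def by (intro INF_lower2[of "(K, l)"]) auto
    then show ?thesis
      using c(2) le_less_trans by blast
  qed
  \<comment> \<open>One squeeze serves both sequences: monotonicity carries the bound from a single
    index to all later ones.\<close>
  have lim: "f \<longlonglongrightarrow> ?\<alpha>" if "decseq f" "\<And>r. ?\<alpha> \<le> f r" "\<And>r. f r \<le> gamma_bound E r" for f
  proof (rule order_tendstoI)
    fix a assume "?\<alpha> < a"
    then obtain r where "gamma_bound E r < a"
      using small by blast
    then have "f s < a" if "r \<le> s" for s
      using \<open>decseq f\<close>[THEN decseqD, OF that] \<open>f r \<le> gamma_bound E r\<close> by (metis le_less_trans)
    then show "\<forall>\<^sub>F r in sequentially. f r < a"
      by (auto simp: eventually_sequentially)
  qed (use that(2) in \<open>auto intro!: always_eventually intro: less_le_trans\<close>)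
  show ?thesis
    using lim[OF dec(1)] lim[OF dec(2)] le_nu nu_le dec order_trans by blast
qed

end
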